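(* Let $f:\mathbb{R}^n\to\mathbb{R}$ be differentiable and $L$-smooth with $L>0$, i.e. $f(\mathbf{x}+\mathbf{h})\le f(\mathbf{x})+\langle\nabla f(\mathbf{x}),\mathbf{h}\rangle+\frac{L}{2}\|\mathbf{h}\|^2$ for all $\mathbf{x},\mathbf{h}\in\mathbb{R}^n$. Let $\mu>0$ and assume that $f$ is weakly Polyak-Łojasiewicz with parameter $\mu$: there is a global minimizer $\mathbf{x}^*$ of $f$ such that $\sqrt{\mu}\,\xi(\mathbf{x})\le\|\nabla f(\mathbf{x})\|\cdot\|\mathbf{x}-\mathbf{x}^*\|$ for all $\mathbf{x}\in\mathbb{R}^n$, where $\xi(\mathbf{x}):=f(\mathbf{x})-f(\mathbf{x}^* )$. Let $\mathbf{x}^0\in\mathbb{R}^n$ and let $\mathbf{x}^{k+1}=\mathbf{x}^k-\frac1L\nabla f(\mathbf{x}^k)$ for all $k\ge0$. Then for all $k\ge1$, $$\xi(\mathbf{x}^k)\;\le\;\frac{\xi(\mathbf{x}^0)}{1+\xi(\mathbf{x}^0)\,\frac{\mu}{2L}\sum_{t=0}^{k-1}\frac{1}{\|\mathbf{x}^t-\mathbf{x}^*\|^2}}\;\le\;\frac{2L}{\mu}\cdot\frac{1}{\sum_{t=0}^{k-1}\frac{1}{\|\mathbf{x}^t-\mathbf{x}^*\|^2}}.$$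
   Context: $\|\cdot\|$ is the Euclidean norm. The point $\mathbf{x}^*$ in the bound is the minimizer appearing in the weak Polyak-Łojasiewicz inequality. Convention for degenerate cases: if $\mathbf{x}^t=\mathbf{x}^*$ for some $t\le k-1$, then $1/\|\mathbf{x}^t-\mathbf{x}^*\|^2:=+\infty$, with $0\cdot\infty:=0$ and $a/\infty:=0$ (so one may equivalently assume $\mathbf{x}^t\ne\mathbf{x}^*$ for $t=0,\dots,k-1$). *)

theory Defs
  imports "HOL-Analysis.Analysis"
begin

definition gradient :: "('a::real_inner \<Rightarrow> real) \<Rightarrow> 'a \<Rightarrow> 'a"
  where "gradient f x = (THE g. GDERIV f x :> g)"

lemma gradient_eqI:
  assumes "GDERIV f x :> g"
  shows "gradient f x = g"
proof -
  have "g' = g" if "GDERIV f x :> g'" for g'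
  proof -
    have "(\<lambda>h. h \<bullet> g') = (\<lambda>h. h \<bullet> g)"
      using that assms unfolding gderiv_def by (rule has_derivative_unique)
    then have "(g' - g) \<bullet> g' = (g' - g) \<bullet> g"
      by (rule fun_cong)
    then have "(g' - g) \<bullet> (g' - g) = 0"
      by (simp add: inner_diff_right)
    then show ?thesis by simp
  qed
  with assms show ?thesis
    unfolding gradient_def by (intro the_equality)
qed

lemma gderiv_gradient:
  fixes f :: "'a::euclidean_space \<Rightarrow> real"
  assumes "f differentiable (at x)"
  shows "GDERIV f x :> gradient f x"
proof -
  obtain f' where f': "(f has_derivative f') (at x)"
    using assms unfolding differentiable_def by blast
  then have lin: "linear f'"
    by (rule has_derivative_linear)
  have "f' = (\<lambda>h. h \<bullet> adjoint f' 1)"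
    using adjoint_works[OF lin, of _ 1] by (auto simp: fun_eq_iff)
  with f' have "GDERIV f x :> adjoint f' 1"
    by (simp add: gderiv_def)
  then show ?thesis
    using gradient_eqI by metis
qed

definition L_smooth :: "real \<Rightarrow> ('a::real_inner \<Rightarrow> real) \<Rightarrow> bool"
  where "L_smooth L f \<longleftrightarrow>
    (\<forall>x h. f (x + h) \<le> f x + gradient f x \<bullet> h + L / 2 * (norm h)\<^sup>2)"

definition global_minimizer :: "('a \<Rightarrow> real) \<Rightarrow> 'a \<Rightarrow> bool"
  where "global_minimizer f xs \<longleftrightarrow> (\<forall>y. f xs \<le> f y)"

definition gap :: "('a \<Rightarrow> real) \<Rightarrow> 'a \<Rightarrow> 'a \<Rightarrow> real"
  where "gap f xs x = f x - f xs"

text \<open>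
  The witnessing minimizer \<open>xs\<close> is a parameter of the predicate, because convergence bounds
  refer to it; \<open>f\<close> is weakly Polyak-Lojasiewicz if this holds for some \<open>xs\<close>.
\<close>

definition weakly_PL_wrt :: "real \<Rightarrow> ('a::real_inner \<Rightarrow> real) \<Rightarrow> 'a \<Rightarrow> bool"
  where "weakly_PL_wrt \<mu> f xs \<longleftrightarrow>
    global_minimizer f xs \<and>
    (\<forall>x. sqrt \<mu> * gap f xs x \<le> norm (gradient f x) * norm (x - xs))"

text \<open>
  The sum is taken in \<^typ>\<open>ereal\<close>, where \<open>1 / 0 = \<infinity>\<close>, \<open>0 * \<infinity> = 0\<close> and \<open>a / \<infinity> = 0\<close> for real \<open>a\<close>.
  In \<^typ>\<open>real\<close>, an iterate equal to \<open>xs\<close> would contribute \<open>1 / 0 = 0\<close> instead of \<open>\<infinity>\<close>.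
\<close>

definition inv_sq_dist_sum :: "(nat \<Rightarrow> 'a::real_normed_vector) \<Rightarrow> 'a \<Rightarrow> nat \<Rightarrow> ereal"
  where "inv_sq_dist_sum x xs k = (\<Sum>t<k. 1 / ereal ((norm (x t - xs))\<^sup>2))"

end

theory Submission
  imports Defs
begin

text \<open>
  One gradient step decreases the gap by at least \<open>\<parallel>gradient f x\<parallel>\<^sup>2 / (2 * L)\<close>, and the weak
  Polyak-Lojasiewicz inequality bounds this from below, so the gaps \<open>b\<^sub>t\<close> satisfy
  \<open>b\<^sub>t\<^sub>+\<^sub>1 \<le> b\<^sub>t - c * r\<^sub>t * b\<^sub>t\<^sup>2\<close> with \<open>c = \<mu> / (2 * L)\<close> and \<open>r\<^sub>t = 1 / \<parallel>x\<^sub>t - xs\<parallel>\<^sup>2\<close>.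
  Morally \<open>1 / b\<^sub>t\<^sub>+\<^sub>1 \<ge> 1 / b\<^sub>t + c * r\<^sub>t\<close>, which telescopes. If some iterate equals \<open>xs\<close>,
  monotonicity makes all later gaps zero.
\<close>

text \<open>The reason is \<open>(1 - s * b) * (1 + s * b) \<le> 1\<close>, which turns
  \<open>step\<close> into \<open>b' * (1 + s * b) \<le> b\<close>. Stating reciprocal bounds as
  products keeps vanishing gaps admissible.\<close>

lemma recip_recursion_step:
  fixes b b' q g s :: real
  assumes "0 \<le> b" "0 \<le> b'" "0 \<le> g" "0 \<le> s"
    and bq: "b * q \<le> g" and step: "b' \<le> b - s * b\<^sup>2"
  shows "b' * (q + g * s) \<le> g"
proof (cases "b = 0")
  case True
  \<comment> \<open>Here \<open>step\<close> forces \<open>b' = 0\<close>.\<close>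
  with assms show ?thesis by simp
next
  case False
  with \<open>0 \<le> b\<close> have "b > 0" by simp
  have "b' * (1 + s * b) \<le> (b - s * b\<^sup>2) * (1 + s * b)"
    using step assms by (intro mult_right_mono) auto
  also have "\<dots> = b - b * (s * b)\<^sup>2"
    by (simp add: algebra_simps power2_eq_square)
  also have "\<dots> \<le> b"
    using \<open>0 \<le> b\<close> by simp
  finally have le: "b' * (1 + s * b) \<le> b" .
  have "(b' * (q + g * s)) * b = b' * (b * q + g * s * b)"
    by (simp add: algebra_simps)
  also have "\<dots> \<le> b' * (g + g * s * b)"
    using bq \<open>0 \<le> b'\<close> by (intro mult_left_mono) auto
  also have "\<dots> = g * (b' * (1 + s * b))"
    by (simp add: algebra_simps)
  also have "\<dots> \<le> g * b"
    using le \<open>0 \<le> g\<close> by (rule mult_left_mono)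
  finally show ?thesis
    using \<open>b > 0\<close> by simp
qed

lemma recip_recursion:
  fixes b r :: "nat \<Rightarrow> real"
  assumes "\<And>t. 0 \<le> b t" "\<And>t. 0 \<le> r t" "0 \<le> c"
    and "\<And>t. b (Suc t) \<le> b t - c * r t * (b t)\<^sup>2"
  shows "b k * (1 + b 0 * c * (\<Sum>t<k. r t)) \<le> b 0"
proof (induction k)
  case 0
  then show ?case by simp
next
  case (Suc k)
  have "b (Suc k) * ((1 + b 0 * c * (\<Sum>t<k. r t)) + b 0 * (c * r k)) \<le> b 0"
    \<comment> \<open>The constants are \<open>g = b 0\<close>, \<open>s = c * r k\<close>, and
      \<open>q\<close> is the denominator accumulated so far, so the induction hypothesis is the
      premise \<open>b * q \<le> g\<close>.\<close>
    using assms Suc.IH by (intro recip_recursion_step[where b = "b k"]) auto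
  then show ?case by (simp add: algebra_simps)
qed

lemma gap_nonneg: "global_minimizer f xs \<Longrightarrow> 0 \<le> gap f xs x"
  by (simp add: global_minimizer_def gap_def)

text \<open>The step \<open>h = - (1 / L) *\<^sub>R gradient f x\<close> minimizes the quadratic
  upper bound given by smoothness; inserting it yields the decrease.\<close>

lemma gradient_step_descent:
  assumes "L_smooth L f" "L > 0"
  shows "f (x - (1 / L) *\<^sub>R gradient f x) \<le> f x - (norm (gradient f x))\<^sup>2 / (2 * L)"
proof -
  let ?g = "gradient f x"
  have "f (x + - (1 / L) *\<^sub>R ?g) \<le>
      f x + ?g \<bullet> (- (1 / L) *\<^sub>R ?g) + L / 2 * (norm (- (1 / L) *\<^sub>R ?g))\<^sup>2"
    using assms(1) unfolding L_smooth_def by blast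
  also have "?g \<bullet> (- (1 / L) *\<^sub>R ?g) = - ((norm ?g)\<^sup>2 / L)"
    by (simp add: power2_norm_eq_inner)
  also have "L / 2 * (norm (- (1 / L) *\<^sub>R ?g))\<^sup>2 = (norm ?g)\<^sup>2 / (2 * L)"
    using \<open>L > 0\<close> by (simp add: power_divide power2_eq_square)
  also have "f x + - ((norm ?g)\<^sup>2 / L) + (norm ?g)\<^sup>2 / (2 * L) = f x - (norm ?g)\<^sup>2 / (2 * L)"
    by simp
  finally show ?thesis by simp
qed

text \<open>For \<open>x = xs\<close> the quotient below is \<open>0\<close>, and the bound is plain monotonicity.\<close>

lemma gap_gradient_step:
  assumes "L_smooth L f" "L > 0" "weakly_PL_wrt \<mu> f xs" "\<mu> > 0"
  shows "gap f xs (x - (1 / L) *\<^sub>R gradient f x)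
    \<le> gap f xs x - \<mu> / (2 * L) * (1 / (norm (x - xs))\<^sup>2) * (gap f xs x)\<^sup>2"
proof -
  let ?g = "norm (gradient f x)" and ?d = "norm (x - xs)" and ?b = "gap f xs x"
  have "0 \<le> ?b" and pl: "sqrt \<mu> * ?b \<le> ?g * ?d"
    using assms(3) by (auto simp: weakly_PL_wrt_def gap_nonneg)
  have "(sqrt \<mu> * ?b)\<^sup>2 \<le> (?g * ?d)\<^sup>2"
    using pl \<open>0 \<le> ?b\<close> \<open>\<mu> > 0\<close> by (intro power_mono) auto
  then have "\<mu> * ?b\<^sup>2 \<le> ?g\<^sup>2 * ?d\<^sup>2"
    using \<open>\<mu> > 0\<close> by (simp add: power_mult_distrib)
  then have "\<mu> * ?b\<^sup>2 / ?d\<^sup>2 \<le> ?g\<^sup>2"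
    by (cases "?d = 0") (auto simp: divide_le_eq)
  then have "\<mu> * ?b\<^sup>2 / ?d\<^sup>2 / (2 * L) \<le> ?g\<^sup>2 / (2 * L)"
    using \<open>L > 0\<close> by (intro divide_right_mono) auto
  moreover have "\<mu> / (2 * L) * (1 / ?d\<^sup>2) * ?b\<^sup>2 = \<mu> * ?b\<^sup>2 / ?d\<^sup>2 / (2 * L)"
    by simp
  ultimately show ?thesis
    using gradient_step_descent[OF assms(1,2), of x] unfolding gap_def by linarith
qed

lemma inv_sq_dist_sum_eq_ereal:
  assumes "\<And>t. t < k \<Longrightarrow> x t \<noteq> xs"
  shows "inv_sq_dist_sum x xs k = ereal (\<Sum>t<k. 1 / (norm (x t - xs))\<^sup>2)"
proof -
  have "inv_sq_dist_sum x xs k = (\<Sum>t<k. ereal (1 / (norm (x t - xs))\<^sup>2))"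
    unfolding inv_sq_dist_sum_def
    by (intro sum.cong) (auto simp: assms one_ereal_def)
  then show ?thesis by simp
qed

text \<open>The summand at \<open>t\<close> is \<open>1 / 0 = \<infinity>\<close> in
  \<open>ereal\<close>, and no summand is \<open>-\<infinity>\<close>.\<close>

lemma inv_sq_dist_sum_eq_PInfty:
  assumes "t < k" "x t = xs"
  shows "inv_sq_dist_sum x xs k = \<infinity>"
proof -
  have "1 / ereal ((norm (x t - xs))\<^sup>2) = \<infinity>"
    using assms(2) by (simp add: divide_ereal_def)
  moreover have "1 / ereal ((norm (x s - xs))\<^sup>2) \<noteq> - \<infinity>" for s
    by (cases "x s = xs") (auto simp: divide_ereal_def one_ereal_def)
  ultimately show ?thesis
    unfolding inv_sq_dist_sum_def using assms(1) by (subst sum_Pinfty) auto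
qed

theorem theorem5:
  fixes f :: "real ^ 'n \<Rightarrow> real" and L \<mu> :: real
    and xs :: "real ^ 'n" and x :: "nat \<Rightarrow> real ^ 'n"
  assumes "\<And>y. f differentiable (at y)"
    and "L > 0" and "L_smooth L f"
    and "\<mu> > 0" and "weakly_PL_wrt \<mu> f xs"
    and "\<And>k. x (Suc k) = x k - (1 / L) *\<^sub>R gradient f (x k)"
    and "k \<ge> 1"
  shows "ereal (gap f xs (x k))
      \<le> ereal (gap f xs (x 0)) /
          (1 + ereal (gap f xs (x 0)) * ereal (\<mu> / (2 * L)) * inv_sq_dist_sum x xs k) \<and>
    ereal (gap f xs (x 0)) /
          (1 + ereal (gap f xs (x 0)) * ereal (\<mu> / (2 * L)) * inv_sq_dist_sum x xs k)
      \<le> ereal (2 * L / \<mu>) * (1 / inv_sq_dist_sum x xs k)"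
proof -
  define b where "b t = gap f xs (x t)" for t
  define r where "r t = 1 / (norm (x t - xs))\<^sup>2" for t
  define c where "c = \<mu> / (2 * L)"
  have "c > 0" using assms by (simp add: c_def)
  have b_nonneg: "0 \<le> b t" for t
    using assms(5) by (simp add: b_def weakly_PL_wrt_def gap_nonneg)
  have r_nonneg: "0 \<le> r t" for t
    by (simp add: r_def)
  have step: "b (Suc t) \<le> b t - c * r t * (b t)\<^sup>2" for t
    unfolding b_def r_def c_def assms(6)
    using gap_gradient_step[OF assms(3,2,5,4)] .
  have "ereal (b k) \<le> ereal (b 0) / (1 + ereal (b 0) * ereal c * inv_sq_dist_sum x xs k) \<and>
    ereal (b 0) / (1 + ereal (b 0) * ereal c * inv_sq_dist_sum x xs k)
      \<le> ereal (2 * L / \<mu>) * (1 / inv_sq_dist_sum x xs k)"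
  \<comment> \<open>The real-valued \<open>r t\<close> matches the \<open>ereal\<close> summand only
    when \<open>x t \<noteq> xs\<close>, so an iterate that hits \<open>xs\<close> is treated
    separately.\<close>
  proof (cases "\<exists>t<k. x t = xs")
    case True
    then obtain t where t: "t < k" "x t = xs" by blast
    have "b (Suc s) \<le> b s" for s
    proof -
      have "0 \<le> c * r s * (b s)\<^sup>2"
        using r_nonneg[of s] \<open>c > 0\<close> by simp
      with step[of s] show ?thesis by linarith
    qed
    then have "b k \<le> b t"
      by (rule lift_Suc_antimono_le[of b]) (simp add: t(1) less_imp_le)
    then have "b k = 0"
      using t(2) b_nonneg[of k] by (simp add: b_def gap_def)
    \<comment> \<open>If \<open>b 0 = 0\<close>, then \<open>0 * \<infinity> = 0\<close> leaves
      \<open>0 / 1\<close>; otherwise the denominator is \<open>\<infinity>\<close>.\<close>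
    moreover have "ereal (b 0) / (1 + ereal (b 0) * ereal c * \<infinity>) = 0"
      using b_nonneg[of 0] \<open>c > 0\<close> by (cases "b 0 = 0") (auto simp flip: zero_ereal_def)
    ultimately show ?thesis
      by (simp add: inv_sq_dist_sum_eq_PInfty[of t k x xs, OF t] flip: zero_ereal_def)
  next
    case False
    define S where "S = (\<Sum>t<k. r t)"
    have S: "inv_sq_dist_sum x xs k = ereal S"
      using False by (auto simp: S_def r_def intro: inv_sq_dist_sum_eq_ereal)
    \<comment> \<open>\<open>k \<ge> 1\<close> makes the index set nonempty, so that
      \<open>1 / S\<close> below is a genuine reciprocal.\<close>
    have "S > 0"
      unfolding S_def using False \<open>k \<ge> 1\<close> by (intro sum_pos) (auto simp: r_def lessThan_empty_iff)
    define D where "D = 1 + b 0 * c * S"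
    have "D > 0"
      using b_nonneg[of 0] \<open>c > 0\<close> \<open>S > 0\<close> by (simp add: D_def add_pos_nonneg)
    have "b k * D \<le> b 0"
      unfolding D_def S_def
      using recip_recursion[of b r c k] b_nonneg r_nonneg \<open>c > 0\<close> step by simp
    then have le1: "b k \<le> b 0 / D"
      using \<open>D > 0\<close> by (simp add: le_divide_eq)
    \<comment> \<open>Dropping the summand \<open>1\<close> from \<open>D\<close> leaves
      \<open>b 0 * c * S\<close>, and \<open>b 0\<close> cancels; the cross-multiplied form also
      covers \<open>b 0 = 0\<close>.\<close>
    have "b 0 / D \<le> 1 / (c * S)"
      using \<open>D > 0\<close> \<open>c > 0\<close> \<open>S > 0\<close> by (simp add: D_def field_simps)
    also have "\<dots> = 2 * L / \<mu> * (1 / S)"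
      by (simp add: c_def)
    finally have le2: "b 0 / D \<le> 2 * L / \<mu> * (1 / S)" .
    have "1 + ereal (b 0) * ereal c * inv_sq_dist_sum x xs k = ereal D"
      by (simp add: S D_def one_ereal_def)
    then show ?thesis
      using le1 le2 \<open>D > 0\<close> \<open>S > 0\<close> by (simp add: S one_ereal_def)
  qed
  then show ?thesis
    by (simp add: b_def c_def)
qed

end
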